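(* Fix $c \in \mathbb{Z}^+$ and a deletion probability $q$ with $q < \frac{c}{c+1}$. There exists a finite constant $C$, depending only on $c$ and $q$, such that for any integer $k > c$ the following holds: in the TED deletion model, $T=\exp(C k\log_k n)$ independent traces suffice to reconstruct the binary labels of a complete $k$-ary tree on $n$ nodes with high probability. That is, there is an estimator which, given the tree topology, $q$, and $T$ independent TED traces of the labeled tree $X$, outputs the labeling of $X$ with probability tending to $1$ as $n\to\infty$.
   Context: Tree trace reconstruction: $X$ is a rooted tree of known topology whose $n$ non-root nodes carry unknown binary labels; the children of every node have a left-to-right order. A complete $k$-ary tree is a rooted tree in which every non-leaf node has exactly $k$ children (all leaves at the same depth). TED (Tree Edit Distance) deletion model with parameter $q$: each non-root node is deleted independently with probability $q$ (the root is never deleted); deletions are associative, and when a node $v$ is deleted, all of its children become children of the parent of $v$ (equivalently, the edge between $v$ and its parent is contracted, keeping the parent's label), taking the place of $v$ in the left-to-right order among the parent's children (surviving original siblings left of $v$ stay to the left of $v$'s children, those right of $v$ stay to the right). The resulting labeled ordered rooted tree is a trace. The goal is to recover the labels of $X$ from independent traces, knowing only the deletion model, $q$, and the topology of $X$; "with high probability" means with probability tending to $1$ as $n \to \infty$. *)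

theory Defs
  imports "HOL-Probability.Probability_Mass_Function"
begin

text \<open>
  Ordered rooted trees. Only non-root nodes carry a label, so the root has its own constructor;
  the children of a node are listed from left to right.
\<close>

datatype 'a vtree = Vertex 'a "'a vtree list"

datatype 'a rtree = Root (children: "'a vtree list")

definition tree_topology :: "'a rtree \<Rightarrow> unit rtree" where
  "tree_topology = map_rtree (\<lambda>_. ())"

fun forest_size :: "'a vtree list \<Rightarrow> nat" where
  "forest_size [] = 0"
| "forest_size (Vertex a us # ts) = 1 + forest_size us + forest_size ts"

definition num_nonroot :: "'a rtree \<Rightarrow> nat" where
  "num_nonroot X = forest_size (children X)"

text \<open>
  \<open>kary_forest k d ts\<close>: a node with child list \<open>ts\<close> is the root of a complete \<open>k\<close>-ary tree
  all of whose leaves are exactly \<open>d\<close> levels below it.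
\<close>

fun kary_forest :: "nat \<Rightarrow> nat \<Rightarrow> 'a vtree list \<Rightarrow> bool" where
  "kary_forest k 0 ts \<longleftrightarrow> ts = []"
| "kary_forest k (Suc d) ts \<longleftrightarrow>
     length ts = k \<and> (\<forall>a us. Vertex a us \<in> set ts \<longrightarrow> kary_forest k d us)"

definition complete_kary :: "nat \<Rightarrow> 'a rtree \<Rightarrow> bool" where
  "complete_kary k X \<longleftrightarrow> (\<exists>d. kary_forest k d (children X))"

text \<open>
  Tree Edit Distance deletions below a node that is kept. Every vertex draws its own independent
  coin, which is \<open>True\<close> (delete) with probability \<open>q\<close>. A deleted vertex is replaced, at its
  position among its siblings, by the list of its children, which are themselves already the
  result of the deletions further down; as deletions are associative, the order in which the
  vertices are processed is immaterial.
\<close>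

fun ted_forest :: "real \<Rightarrow> 'a vtree list \<Rightarrow> 'a vtree list pmf" where
  "ted_forest q [] = return_pmf []"
| "ted_forest q (Vertex a us # ts) =
     do {
       del \<leftarrow> bernoulli_pmf q;
       us' \<leftarrow> ted_forest q us;
       ts' \<leftarrow> ted_forest q ts;
       return_pmf ((if del then us' else [Vertex a us']) @ ts')
     }"

definition ted_trace :: "real \<Rightarrow> 'a rtree \<Rightarrow> 'a rtree pmf" where
  "ted_trace q X = map_pmf Root (ted_forest q (children X))"

end

theory Submission imports Defs
begin

text \<open>
  Deletions never increase depth, so a vertex at depth \<open>d\<close> of a trace of a complete tree of depth
  \<open>d\<close> is an original leaf none of whose ancestors was deleted. Hence the vertices of a trace that
  have a descendant at depth \<open>d\<close> are exactly the vertices lying on surviving root-to-leaf paths,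
  at their original depth and in their original order. Surviving paths form a branching process
  whose mean offspring \<open>k (1 - q) \<ge> (c + 1) (1 - q)\<close> exceeds \<open>1\<close>, so each vertex reaches depth \<open>d\<close> with
  probability at least some \<open>\<theta> > 0\<close> depending on \<open>c\<close> and \<open>q\<close> only. With probability at least
  \<open>((1 - q) \<theta>) ^ (k d)\<close> every vertex on a prescribed root-to-leaf path therefore has all of its \<open>k\<close>
  children on surviving paths. This can be seen in the trace, and it reveals where the prescribed
  path is, so its labels can be read off without error. A union bound over the at most \<open>n\<close> paths
  shows that \<open>exp (C k d)\<close> traces suffice to read every path at least once.
\<close>

section \<open>Reading a path in a trace\<close>

primrec label :: "'a vtree \<Rightarrow> 'a" where
  "label (Vertex a us) = a"

primrec subforest :: "'a vtree \<Rightarrow> 'a vtree list" where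
  "subforest (Vertex a us) = us"

lemma vertex_label_subforest: "Vertex (label t) (subforest t) = t"
  by (cases t) simp

fun forest_height :: "'a vtree list \<Rightarrow> nat" where
  "forest_height [] = 0"
| "forest_height (Vertex a us # ts) = max (Suc (forest_height us)) (forest_height ts)"

lemma forest_height_append:
  "forest_height (ts @ us) = max (forest_height ts) (forest_height us)"
  by (induction ts rule: forest_height.induct) auto

text \<open>In the child list of a vertex, the trees kept are those that reach \<open>d\<close>
  levels below that vertex, in unchanged order. When \<open>d\<close> is the number of levels below
  it in the original tree, they are the children on surviving paths.\<close>

definition deep :: "nat \<Rightarrow> 'a vtree list \<Rightarrow> 'a vtree list" where
  "deep d ts = filter (\<lambda>t. d \<le> forest_height [t]) ts"

lemma deep_Nil [simp]: "deep d [] = []"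
  by (simp add: deep_def)

lemma deep_Suc_Cons:
  "deep (Suc d) (Vertex a us # ts) =
     (if d \<le> forest_height us then [Vertex a us] else []) @ deep (Suc d) ts"
  by (simp add: deep_def)

lemma deep_append: "deep d (ts @ us) = deep d ts @ deep d us"
  by (simp add: deep_def)

lemma deep_eq_Nil_iff: "deep (Suc d) ts = [] \<longleftrightarrow> forest_height ts \<le> d"
  by (induction ts rule: forest_height.induct) (auto simp: deep_Suc_Cons)

fun path_labels :: "nat list \<Rightarrow> 'a vtree list \<Rightarrow> 'a list" where
  "path_labels [] ts = []"
| "path_labels (i # is) ts = label (ts ! i) # path_labels is (subforest (ts ! i))"

text \<open>
  In the following two functions, the length of the address is the depth of the original tree.
\<close>

fun path_resolved :: "nat \<Rightarrow> nat list \<Rightarrow> 'a vtree list \<Rightarrow> bool" where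
  "path_resolved k [] ts \<longleftrightarrow> True"
| "path_resolved k (i # is) ts \<longleftrightarrow>
     length (deep (Suc (length is)) ts) = k \<and>
     path_resolved k is (subforest (deep (Suc (length is)) ts ! i))"

fun read_path :: "nat list \<Rightarrow> 'a vtree list \<Rightarrow> 'a list" where
  "read_path [] ts = []"
| "read_path (i # is) ts =
     label (deep (Suc (length is)) ts ! i) #
     read_path is (subforest (deep (Suc (length is)) ts ! i))"

text \<open>Resolution demands \<open>k > 0\<close> deep trees at the current level, and a single
  one already attains the full height. Hence a resolved subtree needs no separate survival condition
  when probabilities are estimated.\<close>

lemma path_resolved_imp_height:
  assumes "path_resolved k is ts" "0 < k"
  shows "length is \<le> forest_height ts"
proof (cases "is")
  case (Cons i js)
  then have "deep (Suc (length js)) ts \<noteq> []"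
    using assms by auto
  then show ?thesis
    using Cons deep_eq_Nil_iff[of "length js" ts] by simp
qed simp

section \<open>Complete trees: addresses of leaves, shape and size\<close>

definition addresses :: "nat \<Rightarrow> nat \<Rightarrow> nat list set" where
  "addresses k d = {is. set is \<subseteq> {..<k} \<and> length is = d}"

lemma finite_addresses: "finite (addresses k d)"
  and card_addresses: "card (addresses k d) = k ^ d"
  using finite_lists_length_eq[of "{..<k}" d] card_lists_length_eq[of "{..<k}" d]
  by (simp_all add: addresses_def)

lemma Cons_in_addresses_iff:
  "i # is \<in> addresses k (Suc d) \<longleftrightarrow> i < k \<and> is \<in> addresses k d"
  by (auto simp: addresses_def)

lemma kary_forest_subforest:
  assumes "kary_forest k (Suc d) ts" "t \<in> set ts"
  shows "kary_forest k d (subforest t)"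
  using assms vertex_label_subforest[of t] by (metis kary_forest.simps(2))

lemma kary_forest_height: "kary_forest k d ts \<Longrightarrow> forest_height ts \<le> d"
proof (induction d arbitrary: ts)
  case (Suc d)
  have "forest_height us \<le> Suc d" if "\<forall>t\<in>set us. forest_height (subforest t) \<le> d"
    for us :: "'a vtree list"
    using that by (induction us rule: forest_height.induct) auto
  then show ?case
    using Suc.IH kary_forest_subforest[OF Suc.prems] by blast
qed simp

lemma path_labels_inject:
  assumes "kary_forest k d ts" "kary_forest k d us" "0 < k"
    and "\<And>is. is \<in> addresses k d \<Longrightarrow> path_labels is ts = path_labels is us"
  shows "ts = us"
  using assms
proof (induction d arbitrary: ts us)
  case (Suc d)
  have len: "length ts = k" "length us = k"
    using Suc.prems by auto
  have "ts ! i = us ! i" if i: "i < k" for i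
  proof -
    have eq: "label (ts ! i) = label (us ! i) \<and>
        path_labels is (subforest (ts ! i)) = path_labels is (subforest (us ! i))"
      if "is \<in> addresses k d" for "is"
      using Suc.prems(4)[of "i # is"] i that by (simp add: Cons_in_addresses_iff)
    \<comment> \<open>The label of child \<open>i\<close> is compared only through addresses that
      continue below it, so at least one must exist; \<open>0 < k\<close> provides the
      leftmost.\<close>
    have "replicate d 0 \<in> addresses k d"
      using \<open>0 < k\<close> by (auto simp: addresses_def)
    moreover have "subforest (ts ! i) = subforest (us ! i)"
      using Suc.prems i len eq by (intro Suc.IH) (auto intro: kary_forest_subforest)
    ultimately show ?thesis
      using eq vertex_label_subforest by metis
  qed
  then show ?case
    by (intro nth_equalityI) (simp_all add: len)
qed simp

lemma kary_forest_map: "kary_forest k d (map (map_vtree f) ts) \<longleftrightarrow> kary_forest k d ts"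
proof (induction d arbitrary: ts)
  case (Suc d)
  have "(\<forall>a us. Vertex a us \<in> set (map (map_vtree f) ts) \<longrightarrow> kary_forest k d us) \<longleftrightarrow>
        (\<forall>t\<in>set ts. kary_forest k d (subforest (map_vtree f t)))"
    by (metis (no_types, lifting) subforest.simps vertex_label_subforest list.set_map
        imageE imageI)
  also have "\<dots> \<longleftrightarrow> (\<forall>t\<in>set ts. kary_forest k d (subforest t))"
  proof (intro ball_cong refl)
    show "kary_forest k d (subforest (map_vtree f t)) = kary_forest k d (subforest t)" for t
      by (cases t) (simp add: Suc.IH)
  qed
  also have "\<dots> \<longleftrightarrow> (\<forall>a us. Vertex a us \<in> set ts \<longrightarrow> kary_forest k d us)"
    by (metis subforest.simps vertex_label_subforest)
  finally show ?case
    by simp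
qed simp

lemma children_tree_topology:
  "children (tree_topology X) = map (map_vtree (\<lambda>_. ())) (children X)"
  by (cases X) (simp add: tree_topology_def)

lemma kary_forest_topology_cong:
  assumes "tree_topology X = tree_topology Y"
  shows "kary_forest k d (children X) \<longleftrightarrow> kary_forest k d (children Y)"
  using assms kary_forest_map children_tree_topology by metis

lemma forest_size_ge:
  assumes "\<And>t. t \<in> set ts \<Longrightarrow> m \<le> Suc (forest_size (subforest t))"
  shows "length ts * m \<le> forest_size ts"
  using assms by (induction ts rule: forest_size.induct) (force simp: add_mono)+

text \<open>Counting the leaves alone is enough. This bounds the number of addresses by the number
  of vertices, and the depth by its logarithm.\<close>

lemma kary_forest_size: "kary_forest k (Suc d) ts \<Longrightarrow> k ^ Suc d \<le> forest_size ts"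
proof (induction d arbitrary: ts)
  case 0
  then show ?case
    using forest_size_ge[of ts 1] by simp
next
  case (Suc d)
  have "k ^ Suc d \<le> Suc (forest_size (subforest t))" if "t \<in> set ts" for t
    using Suc.IH kary_forest_subforest[OF Suc.prems that] by (blast intro: le_SucI)
  then show ?case
    using forest_size_ge[of ts "k ^ Suc d"] Suc.prems by simp
qed

section \<open>Surviving paths are read without error\<close>

lemma set_ted_forest_Cons:
  assumes "ys \<in> set_pmf (ted_forest q (Vertex a us # ts))"
  obtains del us' ts' where "us' \<in> set_pmf (ted_forest q us)" "ts' \<in> set_pmf (ted_forest q ts)"
    "ys = (if del then us' else [Vertex a us']) @ ts'"
  using assms by auto

lemma forest_height_trace:
  "ys \<in> set_pmf (ted_forest q ts) \<Longrightarrow> forest_height ys \<le> forest_height ts"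
proof (induction ts arbitrary: ys rule: forest_height.induct)
  case (2 a us ts)
  from "2.prems" obtain del us' ts' where *:
    "us' \<in> set_pmf (ted_forest q us)" "ts' \<in> set_pmf (ted_forest q ts)"
    "ys = (if del then us' else [Vertex a us']) @ ts'"
    by (rule set_ted_forest_Cons)
  have "forest_height us' \<le> forest_height us" "forest_height ts' \<le> forest_height ts"
    using "2.IH" * by blast+
  then show ?case
    using * by (auto simp: forest_height_append)
qed simp

text \<open>A deleted root leaves only the trace of its subforest, of height at most
  \<open>d\<close>, hence nothing deep; a kept root contributes at most itself. If the counts agree,
  every root was therefore kept, and the deep trees match the original ones in order.\<close>

lemma deep_trace:
  assumes "ys \<in> set_pmf (ted_forest q ts)" "forest_height ts \<le> Suc d"
  shows "length (deep (Suc d) ys) \<le> length ts"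
    and "length (deep (Suc d) ys) = length ts \<Longrightarrow>
      list_all2 (\<lambda>t y. label y = label t \<and> subforest y \<in> set_pmf (ted_forest q (subforest t)))
        ts (deep (Suc d) ys)"
  using assms
proof (induction ts arbitrary: ys)
  case (Cons t ts)
  obtain a us where t: "t = Vertex a us"
    by (cases t)
  {
    case 1
    then obtain del us' ts' where *:
      "us' \<in> set_pmf (ted_forest q us)" "ts' \<in> set_pmf (ted_forest q ts)"
      "ys = (if del then us' else [Vertex a us']) @ ts'"
      unfolding t by (blast elim: set_ted_forest_Cons)
    have "deep (Suc d) us' = []"
      using forest_height_trace[OF *(1)] 1 t by (simp add: deep_eq_Nil_iff)
    then show ?case
      using Cons.IH(1)[OF *(2)] 1 t *(3) by (auto simp: deep_append deep_Suc_Cons)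
  next
    case 2
    then obtain del us' ts' where *:
      "us' \<in> set_pmf (ted_forest q us)" "ts' \<in> set_pmf (ted_forest q ts)"
      "ys = (if del then us' else [Vertex a us']) @ ts'"
      unfolding t by (blast elim: set_ted_forest_Cons)
    have "deep (Suc d) us' = []"
      using forest_height_trace[OF *(1)] 2 t by (simp add: deep_eq_Nil_iff)
    moreover have "length (deep (Suc d) ts') \<le> length ts"
      using Cons.IH(1)[OF *(2)] 2 t by simp
    ultimately show ?case
      using Cons.IH(2)[OF _ *(2)] 2 t *(1,3)
      by (auto simp: deep_append deep_Suc_Cons split: if_splits)
  }
qed simp_all

text \<open>At each level, finding \<open>k\<close> deep trees certifies through
  \<open>deep_trace\<close> that no sibling was lost. Index \<open>i\<close> among them is then the
  original child \<open>i\<close>, and what lies below it is again a trace of the original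
  subforest.\<close>

lemma read_path_trace:
  assumes "ys \<in> set_pmf (ted_forest q ts)" "kary_forest k d ts" "is \<in> addresses k d"
    and "path_resolved k is ys"
  shows "read_path is ys = path_labels is ts"
  using assms
proof (induction "is" arbitrary: d ts ys)
  case (Cons i js)
  obtain e where d: "d = Suc e" "e = length js"
    using Cons.prems by (auto simp: addresses_def)
  let ?F = "deep (Suc e) ys"
  have len: "length ts = k" "length ?F = k" and i: "i < k" "js \<in> addresses k e"
    using Cons.prems d by (auto simp: Cons_in_addresses_iff)
  have "list_all2 (\<lambda>t y. label y = label t \<and> subforest y \<in> set_pmf (ted_forest q (subforest t)))
        ts ?F"
    using deep_trace(2)[OF Cons.prems(1), of e] kary_forest_height[OF Cons.prems(2)] d len by simp
  then have "label (?F ! i) = label (ts ! i)"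
    "subforest (?F ! i) \<in> set_pmf (ted_forest q (subforest (ts ! i)))"
    using i len by (auto simp: list_all2_conv_all_nth)
  moreover have "kary_forest k e (subforest (ts ! i))"
    using kary_forest_subforest Cons.prems(2) d i len by (metis nth_mem)
  ultimately show ?case
    using Cons.IH[of "subforest (?F ! i)" "subforest (ts ! i)" e] Cons.prems(4) i d by simp
qed simp

section \<open>The probability that a path can be read\<close>

text \<open>As the image of a product, the recursion lets events factor over the coin, the trace
  below the vertex and the trace of its right siblings.\<close>

lemma ted_forest_Cons_pair:
  "ted_forest q (Vertex a us # ts) =
     map_pmf (\<lambda>((del, us'), ts'). (if del then us' else [Vertex a us']) @ ts')
       (pair_pmf (pair_pmf (bernoulli_pmf q) (ted_forest q us)) (ted_forest q ts))"
  by (simp add: pair_pmf_def map_bind_pmf bind_assoc_pmf bind_return_pmf map_pmf_def)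

lemma prob_pair_pmf_Times:
  "measure_pmf.prob (pair_pmf p r) (A \<times> B) = measure_pmf.prob p A * measure_pmf.prob r B"
proof -
  have "emeasure (pair_pmf p r) (A \<times> B) = (\<integral>\<^sup>+x. indicator (A \<times> B) x \<partial>pair_pmf p r)"
    by simp
  also have "\<dots> = (\<integral>\<^sup>+x. \<integral>\<^sup>+y. indicator A x * indicator B y \<partial>r \<partial>p)"
    by (simp add: nn_integral_pair_pmf' indicator_times)
  also have "\<dots> = emeasure p A * emeasure r B"
    by (simp add: nn_integral_cmult nn_integral_multc)
  finally show ?thesis
    by (simp add: measure_def enn2real_mult)
qed

text \<open>The product is the probability that every root is kept and the independent traces below
  them satisfy their conditions; kept roots retain their positions. Only an inequality holds, since
  a trace can have the right length even though roots were deleted.\<close>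

lemma prob_ted_forest_all_kept:
  assumes q: "0 \<le> q" "q \<le> 1"
  shows "(\<Prod>j<length ts. (1 - q) * measure_pmf.prob (ted_forest q (subforest (ts ! j))) {us. Q j us})
    \<le> measure_pmf.prob (ted_forest q ts)
        {ys. length ys = length ts \<and> (\<forall>j<length ts. Q j (subforest (ys ! j)))}"
proof (induction ts arbitrary: Q)
  case (Cons t ts)
  obtain a us where t: "t = Vertex a us"
    by (cases t)
  let ?B = "{ys. length ys = length ts \<and> (\<forall>j<length ts. Q (Suc j) (subforest (ys ! j)))}"
  let ?f = "\<lambda>((del, us'), ts'). (if del then us' else [Vertex a us']) @ ts'"
  let ?E = "{ys. length ys = length (t # ts) \<and>
    (\<forall>j<length (t # ts). Q j (subforest (ys ! j)))}"
  have "(\<Prod>j<length (t # ts).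
      (1 - q) * measure_pmf.prob (ted_forest q (subforest ((t # ts) ! j))) {us. Q j us}) =
    (1 - q) * measure_pmf.prob (ted_forest q us) {us. Q 0 us} *
      (\<Prod>j<length ts.
        (1 - q) * measure_pmf.prob (ted_forest q (subforest (ts ! j))) {us. Q (Suc j) us})"
    unfolding length_Cons prod.lessThan_Suc_shift by (simp add: t)
  also have "\<dots> \<le> (1 - q) * measure_pmf.prob (ted_forest q us) {us. Q 0 us} *
      measure_pmf.prob (ted_forest q ts) ?B"
    using q by (intro mult_left_mono Cons.IH[of "\<lambda>j. Q (Suc j)"]) simp
  also have "\<dots> = measure_pmf.prob
      (pair_pmf (pair_pmf (bernoulli_pmf q) (ted_forest q us)) (ted_forest q ts))
      (({False} \<times> {us. Q 0 us}) \<times> ?B)"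
    using q by (simp add: prob_pair_pmf_Times measure_pmf_single)
  also have "\<dots> \<le> measure_pmf.prob
      (pair_pmf (pair_pmf (bernoulli_pmf q) (ted_forest q us)) (ted_forest q ts)) (?f -` ?E)"
    by (intro measure_pmf.finite_measure_mono) (auto simp: nth_Cons split: nat.splits)
  also have "\<dots> = measure_pmf.prob (ted_forest q (t # ts)) ?E"
    by (simp only: t ted_forest_Cons_pair measure_map_pmf)
  finally show ?case .
qed simp

text \<open>A trace of height at most \<open>d\<close> has no kept root whose subforest trace
  reaches height \<open>d\<close>. These events are independent over the roots, and the height
  contributed below deleted roots is ignored.\<close>

lemma prob_ted_forest_shallow:
  assumes q: "0 \<le> q" "q \<le> 1" and "0 \<le> \<theta>" "\<theta> \<le> 1"
    and "\<And>t. t \<in> set ts \<Longrightarrow>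
      \<theta> \<le> measure_pmf.prob (ted_forest q (subforest t)) {us. d \<le> forest_height us}"
  shows "measure_pmf.prob (ted_forest q ts) {ys. forest_height ys \<le> d}
    \<le> (1 - (1 - q) * \<theta>) ^ length ts"
  using assms(5)
proof (induction ts)
  case (Cons t ts)
  obtain a us where t: "t = Vertex a us"
    by (cases t)
  let ?A = "{us. d \<le> forest_height us}"
  let ?B = "{ys. forest_height ys \<le> d}"
  let ?f = "\<lambda>((del, us'), ts'). (if del then us' else [Vertex a us']) @ ts'"
  let ?p = "pair_pmf (bernoulli_pmf q) (ted_forest q us)"
  have "measure_pmf.prob (ted_forest q (t # ts)) ?B =
      measure_pmf.prob (pair_pmf ?p (ted_forest q ts)) (?f -` ?B)"
    by (simp only: t ted_forest_Cons_pair measure_map_pmf)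
  also have "\<dots> \<le> measure_pmf.prob (pair_pmf ?p (ted_forest q ts)) ((- ({False} \<times> ?A)) \<times> ?B)"
    by (intro measure_pmf.finite_measure_mono) (auto simp: forest_height_append split: if_splits)
  also have "\<dots> = (1 - (1 - q) * measure_pmf.prob (ted_forest q us) ?A) *
      measure_pmf.prob (ted_forest q ts) ?B"
    using q measure_pmf.prob_compl[of "{False} \<times> ?A" ?p]
    by (simp add: prob_pair_pmf_Times measure_pmf_single Compl_eq_Diff_UNIV)
  also have "\<dots> \<le> (1 - (1 - q) * \<theta>) * (1 - (1 - q) * \<theta>) ^ length ts"
    using q assms(3,4) Cons.prems[of t] Cons.IH[OF Cons.prems]
    by (intro mult_mono diff_left_mono mult_left_mono) (auto simp: t mult_le_one)
  finally show ?case
    by simp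
qed simp

text \<open>Bernoulli's inequality replaces \<open>1 + m x\<close> by \<open>(1 + x) ^ m\<close>,
  and \<open>(1 - x) (1 + x) \<le> 1\<close>. A rational bound makes the survival equation
  explicitly solvable.\<close>

lemma one_minus_power_le_inverse:
  fixes x :: real
  assumes "0 \<le> x" "x \<le> 1"
  shows "(1 - x) ^ m \<le> 1 / (1 + real m * x)"
proof -
  have "(1 - x) ^ m * (1 + real m * x) \<le> (1 - x) ^ m * (1 + x) ^ m"
    using assms Bernoulli_inequality[of x m] by (intro mult_left_mono) auto
  also have "\<dots> = (1 - x\<^sup>2) ^ m"
    by (simp flip: power_mult_distrib add: algebra_simps power2_eq_square)
  also have "\<dots> \<le> 1"
    using assms by (intro power_le_one) (auto simp: power_le_one)
  finally show ?thesis
    using assms by (simp add: field_simps add_pos_nonneg)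
qed

text \<open>
  The value \<open>1 - 1 / (m p)\<close> is chosen so that the bound \<open>(1 - x) ^ m \<le> 1 / (1 + m x)\<close> at
  \<open>x = p \<theta>\<close> is exactly \<open>1 - \<theta>\<close>.
\<close>

lemma survival_fixpoint:
  fixes p :: real
  assumes "0 \<le> p" "p \<le> 1" "1 < real m * p" "m \<le> k"
  defines "\<theta> \<equiv> 1 - 1 / (real m * p)"
  shows "(1 - p * \<theta>) ^ k \<le> 1 - \<theta>"
proof -
  have \<theta>: "0 \<le> \<theta>" "\<theta> \<le> 1"
    using assms by (auto simp: \<theta>_def)
  then have x: "0 \<le> p * \<theta>" "p * \<theta> \<le> 1"
    using assms by (auto simp: mult_le_one)
  \<comment> \<open>Lowering the exponent to \<open>m\<close> gives one value
    \<open>\<theta>\<close> valid for all arities \<open>k \<ge> m\<close>.\<close>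
  have "(1 - p * \<theta>) ^ k \<le> (1 - p * \<theta>) ^ m"
    using x \<open>m \<le> k\<close> by (intro power_decreasing) auto
  also have "\<dots> \<le> 1 / (1 + real m * (p * \<theta>))"
    using x by (rule one_minus_power_le_inverse)
  also have "1 + real m * (p * \<theta>) = real m * p"
    using assms(3) by (cases "m = 0") (auto simp: \<theta>_def field_simps)
  finally show ?thesis
    by (simp add: \<theta>_def)
qed

section \<open>Survival of the branching process and resolution of a path\<close>

locale supercritical_deletion =
  fixes c :: nat and q :: real
  assumes q_nonneg: "0 \<le> q" and supercritical: "q < real c / (real c + 1)"
begin

text \<open>The value from \<open>survival_fixpoint\<close> at the smallest admissible arity
  \<open>c + 1\<close>, so it does not depend on \<open>k\<close>.\<close>

definition \<theta> :: real where "\<theta> = 1 - 1 / (real (Suc c) * (1 - q))"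

lemma q_less_1: "q < 1"
  using supercritical by (rule less_trans) (simp add: field_simps)

lemma mean_offspring_gt_1: "1 < real (Suc c) * (1 - q)"
  using supercritical by (simp add: field_simps)

lemma \<theta>_pos: "0 < \<theta>" and \<theta>_le_1: "\<theta> \<le> 1"
  using mean_offspring_gt_1 by (auto simp: \<theta>_def)

text \<open>Induction on the depth: if survival to depth \<open>d\<close> has probability at least
  \<open>\<theta>\<close>, then extinction before depth \<open>d + 1\<close> has probability at most
  \<open>(1 - (1 - q) \<theta>) ^ k\<close>, which \<open>survival_fixpoint\<close> bounds by
  \<open>1 - \<theta>\<close>.\<close>

lemma prob_survival:
  assumes "c < k" "kary_forest k d ts"
  shows "\<theta> \<le> measure_pmf.prob (ted_forest q ts) {ys. d \<le> forest_height ys}"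
  using assms(2)
proof (induction d arbitrary: ts)
  case 0
  then show ?case
    using \<theta>_le_1 by simp
next
  case (Suc d)
  have "measure_pmf.prob (ted_forest q ts) {ys. forest_height ys \<le> d}
      \<le> (1 - (1 - q) * \<theta>) ^ length ts"
    using q_nonneg q_less_1 \<theta>_pos \<theta>_le_1 Suc.IH kary_forest_subforest[OF Suc.prems]
    by (intro prob_ted_forest_shallow) auto
  also have "\<dots> \<le> 1 - \<theta>"
    using survival_fixpoint[of "1 - q" "Suc c" k] q_nonneg q_less_1 mean_offspring_gt_1 \<open>c < k\<close>
      Suc.prems by (simp add: \<theta>_def)
  finally have "measure_pmf.prob (ted_forest q ts) {ys. forest_height ys \<le> d} \<le> 1 - \<theta>" .
  moreover have "{ys. Suc d \<le> forest_height ys} = UNIV - {ys :: 'a vtree list. forest_height ys \<le> d}"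
    by auto
  ultimately show ?case
    using measure_pmf.prob_compl[of "{ys. forest_height ys \<le> d}" "ted_forest q ts"] by simp
qed

text \<open>Each of the \<open>d\<close> levels costs one factor \<open>(1 - q) \<theta>\<close> for
  each of the \<open>k\<close> siblings there: being kept and reaching the leaf level.\<close>

lemma prob_path_resolved:
  assumes "c < k" "kary_forest k d ts" "is \<in> addresses k d"
  shows "((1 - q) * \<theta>) ^ (k * d) \<le> measure_pmf.prob (ted_forest q ts) {ys. path_resolved k is ys}"
  using assms(2,3)
proof (induction "is" arbitrary: d ts)
  case Nil
  then show ?case
    by (simp add: addresses_def)
next
  case (Cons i js)
  obtain e where d: "d = Suc e" "e = length js"
    using Cons.prems by (auto simp: addresses_def)
  have len: "length ts = k" and i: "i < k" "js \<in> addresses k e"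
    using Cons.prems d by (auto simp: Cons_in_addresses_iff)
  have sub: "kary_forest k e (subforest (ts ! j))" if "j < k" for j
    using kary_forest_subforest Cons.prems(1) d that len by (metis nth_mem)
  define \<alpha> where "\<alpha> = (1 - q) * \<theta>"
  define \<rho> where "\<rho> = \<alpha> ^ (k * e)"
  \<comment> \<open>All \<open>k\<close> subtrees must reach the remaining depth \<open>e\<close>;
    the one on the path must also be resolved further down.\<close>
  define Q where "Q j us \<longleftrightarrow> e \<le> forest_height us \<and> (j = i \<longrightarrow> path_resolved k js us)"
    for j and us :: "'a vtree list"
  have \<alpha>: "0 \<le> \<alpha>" "\<alpha> \<le> 1"
    using q_nonneg q_less_1 \<theta>_pos \<theta>_le_1 by (auto simp: \<alpha>_def mult_le_one)
  then have \<rho>: "0 \<le> \<rho>"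
    by (simp add: \<rho>_def)
  have Qi: "{us. Q i us} = {us. path_resolved k js us}"
    using path_resolved_imp_height[of k js] \<open>c < k\<close> d by (auto simp: Q_def)
  have factor: "\<alpha> * (if j = i then \<rho> else 1)
      \<le> (1 - q) * measure_pmf.prob (ted_forest q (subforest (ts ! j))) {us. Q j us}"
    if j: "j < k" for j
  proof (cases "j = i")
    case True
    have "\<rho> \<le> measure_pmf.prob (ted_forest q (subforest (ts ! i))) {us. Q i us}"
      using Cons.IH[OF sub[OF i(1)] i(2)] by (simp add: Qi \<rho>_def \<alpha>_def)
    \<comment> \<open>For the child on the path, resolution already includes survival. A factor
      \<open>\<theta> \<le> 1\<close> is given away so that all \<open>k\<close> siblings contribute
      the same \<open>\<alpha>\<close>.\<close>
    moreover have "\<theta> * \<rho> \<le> \<rho>"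
      using \<rho> \<theta>_pos \<theta>_le_1 by (simp add: mult_left_le_one_le)
    ultimately have "\<theta> * \<rho> \<le> measure_pmf.prob (ted_forest q (subforest (ts ! i))) {us. Q i us}"
      by linarith
    then show ?thesis
      using True q_less_1 by (simp add: \<alpha>_def mult.assoc)
  next
    case False
    then show ?thesis
      using prob_survival[OF \<open>c < k\<close> sub[OF j]] q_less_1 by (simp add: \<alpha>_def Q_def)
  qed
  have "\<alpha> ^ (k * d) = (\<Prod>j<k. \<alpha> * (if j = i then \<rho> else 1))"
    using i by (simp add: prod.distrib prod.delta d \<rho>_def power_add)
  also have "\<dots> \<le> (\<Prod>j<k.
      (1 - q) * measure_pmf.prob (ted_forest q (subforest (ts ! j))) {us. Q j us})"
    using \<alpha> \<rho> factor by (intro prod_mono) auto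
  also have "\<dots> \<le> measure_pmf.prob (ted_forest q ts)
      {ys. length ys = k \<and> (\<forall>j<k. Q j (subforest (ys ! j)))}"
    using prob_ted_forest_all_kept[of q ts Q] q_nonneg q_less_1 by (simp add: len)
  also have "\<dots> \<le> measure_pmf.prob (ted_forest q ts) {ys. path_resolved k (i # js) ys}"
  proof (intro measure_pmf.finite_measure_mono subsetI CollectI)
    fix ys :: "'a vtree list"
    assume "ys \<in> {ys. length ys = k \<and> (\<forall>j<k. Q j (subforest (ys ! j)))}"
    then have ys: "length ys = k" "\<And>j. j < k \<Longrightarrow> Q j (subforest (ys ! j))"
      by auto
    have "forest_height [y] = Suc (forest_height (subforest y))" for y :: "'a vtree"
      by (cases y) simp
    \<comment> \<open>All \<open>k\<close> trees are deep, so the filter removes nothing and shifts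
      no index.\<close>
    then have "deep (Suc e) ys = ys"
      using ys unfolding deep_def by (intro filter_True) (auto simp: Q_def in_set_conv_nth)
    then show "path_resolved k (i # js) ys"
      using ys i d by (simp add: Q_def)
  qed simp
  finally show ?case
    by (simp add: \<alpha>_def)
qed

end

section \<open>The estimator\<close>

lemma prob_replicate_pmf_all:
  "measure_pmf.prob (replicate_pmf T p) {xs. set xs \<subseteq> A} = measure_pmf.prob p A ^ T"
proof (induction T)
  case (Suc T)
  have "replicate_pmf (Suc T) p = map_pmf (\<lambda>(x, xs). x # xs) (pair_pmf p (replicate_pmf T p))"
    by (simp add: pair_pmf_def map_pmf_def bind_assoc_pmf bind_return_pmf)
  moreover have "(\<lambda>(x, xs). x # xs) -` {xs. set xs \<subseteq> A} = A \<times> {xs. set xs \<subseteq> A}"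
    by auto
  ultimately show ?case
    using Suc by (simp add: prob_pair_pmf_Times)
qed simp

text \<open>Quantifying over \<open>k\<close> and \<open>d\<close> instead of passing them lets the
  estimator work from the topology and the traces alone.\<close>

definition consistent :: "'a rtree \<Rightarrow> 'a rtree list \<Rightarrow> bool" where
  "consistent X Ys \<longleftrightarrow>
     (\<forall>k d. kary_forest k d (children X) \<longrightarrow>
       (\<forall>is\<in>addresses k d. \<forall>Y\<in>set Ys. path_resolved k is (children Y) \<longrightarrow>
         read_path is (children Y) = path_labels is (children X)))"

definition consistent_estimator :: "unit rtree \<Rightarrow> 'a rtree list \<Rightarrow> 'a rtree" where
  "consistent_estimator S Ys = (SOME X. tree_topology X = S \<and> consistent X Ys)"

lemma consistent_traces:
  assumes "set Ys \<subseteq> set_pmf (ted_trace q X)"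
  shows "consistent X Ys"
proof -
  have "children Y \<in> set_pmf (ted_forest q (children X))" if "Y \<in> set Ys" for Y
    using assms that by (auto simp: ted_trace_def)
  then show ?thesis
    unfolding consistent_def using read_path_trace by blast
qed

text \<open>The true tree is always a candidate because reading never errs. It is the only one once
  every path is read in some trace, since the labels along all paths determine the tree.\<close>

lemma consistent_estimator_correct:
  assumes "kary_forest k d (children X)" "0 < k" "set Ys \<subseteq> set_pmf (ted_trace q X)"
    and resolved: "\<And>is. is \<in> addresses k d \<Longrightarrow> \<exists>Y\<in>set Ys. path_resolved k is (children Y)"
  shows "consistent_estimator (tree_topology X) Ys = X"
  unfolding consistent_estimator_def
proof (rule some_equality)
  show "tree_topology X = tree_topology X \<and> consistent X Ys"
    using consistent_traces assms(3) by blast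
next
  fix Z assume Z: "tree_topology Z = tree_topology X \<and> consistent Z Ys"
  then have kary: "kary_forest k d (children Z)"
    using assms(1) kary_forest_topology_cong by blast
  have "children Z = children X"
  proof (rule path_labels_inject[OF kary assms(1,2)])
    fix "is" assume "is \<in> addresses k d"
    then show "path_labels is (children Z) = path_labels is (children X)"
      using resolved Z kary assms(1) consistent_traces[OF assms(3)]
      unfolding consistent_def by metis
  qed
  then show "Z = X"
    by (cases Z, cases X) simp
qed

section \<open>Union bound over the paths and the number of traces\<close>

context supercritical_deletion
begin

lemma prob_path_never_resolved:
  fixes X :: "'a rtree"
  assumes "c < k" "kary_forest k d (children X)" "is \<in> addresses k d"
  shows "measure_pmf.prob (replicate_pmf T (ted_trace q X))
      {Ys. \<forall>Y\<in>set Ys. \<not> path_resolved k is (children Y)}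
    \<le> exp (- (((1 - q) * \<theta>) ^ (k * d) * real T))"
proof -
  let ?r = "((1 - q) * \<theta>) ^ (k * d)"
  let ?R = "{Y. path_resolved k is (children Y)}"
  have "measure_pmf.prob (ted_trace q X) ?R
      = measure_pmf.prob (ted_forest q (children X)) {ys. path_resolved k is ys}"
    by (simp add: ted_trace_def vimage_def)
  then have "measure_pmf.prob (ted_trace q X) (- ?R) \<le> 1 - ?r"
    using prob_path_resolved[OF assms] measure_pmf.prob_compl[of ?R "ted_trace q X"]
    by (simp add: Compl_eq_Diff_UNIV)
  also have "\<dots> \<le> exp (- ?r)"
    using exp_ge_add_one_self[of "- ?r"] by simp
  finally have "measure_pmf.prob (ted_trace q X) (- ?R) ^ T \<le> exp (- ?r) ^ T"
    by (intro power_mono) auto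
  moreover have "{Ys :: 'a rtree list. \<forall>Y\<in>set Ys. \<not> path_resolved k is (children Y)} =
      {Ys. set Ys \<subseteq> - ?R}"
    by auto
  moreover have "exp (- ?r) ^ T = exp (- (?r * real T))"
    by (simp add: mult.commute flip: exp_of_nat_mult)
  ultimately show ?thesis
    by (simp only: prob_replicate_pmf_all)
qed

lemma prob_consistent_estimator:
  assumes "c < k" "kary_forest k d (children X)"
  shows "1 - real (k ^ d) * exp (- (((1 - q) * \<theta>) ^ (k * d) * real T))
    \<le> measure_pmf.prob (replicate_pmf T (ted_trace q X))
        {Ys. consistent_estimator (tree_topology X) Ys = X}"
proof -
  let ?P = "replicate_pmf T (ted_trace q X)"
  let ?E = "{Ys. consistent_estimator (tree_topology X) Ys = X}"
  let ?B = "\<lambda>is. {Ys. \<forall>Y\<in>set Ys. \<not> path_resolved k is (children Y)}"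
  have "1 - measure_pmf.prob ?P ?E = measure_pmf.prob ?P (- ?E)"
    using measure_pmf.prob_compl[of ?E ?P] by (simp add: Compl_eq_Diff_UNIV)
  \<comment> \<open>The estimator is known to be correct only on lists of possible traces, so the
    failure event is restricted to the support.\<close>
  also have "\<dots> = measure_pmf.prob ?P (- ?E \<inter> set_pmf ?P)"
    by (simp add: measure_Int_set_pmf)
  also have "\<dots> \<le> measure_pmf.prob ?P (\<Union>is\<in>addresses k d. ?B is)"
  proof (intro measure_pmf.finite_measure_mono subsetI)
    fix Ys assume Ys: "Ys \<in> - ?E \<inter> set_pmf ?P"
    then have "set Ys \<subseteq> set_pmf (ted_trace q X)"
      by (auto simp: set_replicate_pmf)
    then show "Ys \<in> (\<Union>is\<in>addresses k d. ?B is)"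
      using consistent_estimator_correct[OF assms(2)] assms(1) Ys by fastforce
  qed simp
  also have "\<dots> \<le> (\<Sum>is\<in>addresses k d. measure_pmf.prob ?P (?B is))"
    by (intro measure_pmf.finite_measure_subadditive_finite finite_addresses) auto
  also have "\<dots> \<le> (\<Sum>is\<in>addresses k d. exp (- (((1 - q) * \<theta>) ^ (k * d) * real T)))"
    by (intro sum_mono prob_path_never_resolved assms)
  finally show ?thesis
    by (simp add: card_addresses)
qed

text \<open>With \<open>\<alpha> = (1 - q) \<theta>\<close> and \<open>L = log k n\<close>, the
  number of traces is at least \<open>exp (k L) * \<alpha> powr (- k L)\<close>. The second factor
  offsets \<open>\<alpha> ^ (k d)\<close> because \<open>d \<le> L\<close>, and the first is at
  least \<open>n\<close>. So each path fails with probability at most \<open>exp (- n)\<close>, and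
  there are at most \<open>n\<close> paths.\<close>

lemma consistent_estimator_sample_complexity:
  assumes "c < k" "0 < c" "kary_forest k d (children X)" "0 < d"
  defines "n \<equiv> num_nonroot X"
  assumes T: "exp ((1 - ln ((1 - q) * \<theta>)) * real k * log (real k) (real n)) \<le> real T"
  shows "1 - real n * exp (- real n)
    \<le> measure_pmf.prob (replicate_pmf T (ted_trace q X))
        {Ys. consistent_estimator (tree_topology X) Ys = X}"
proof -
  define \<alpha> where "\<alpha> = (1 - q) * \<theta>"
  define L where "L = log (real k) (real n)"
  have \<alpha>: "0 < \<alpha>" "\<alpha> \<le> 1"
    using q_nonneg q_less_1 \<theta>_pos \<theta>_le_1 by (auto simp: \<alpha>_def mult_le_one)
  have k: "1 < real k"
    using assms by simp
  have kd: "k ^ d \<le> n"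
    using kary_forest_size[of k "d - 1" "children X"] assms(3,4)
    by (simp add: n_def num_nonroot_def)
  moreover have "0 < k ^ d"
    using assms by simp
  ultimately have n: "0 < n"
    by linarith
  have "real d = log (real k) (real (k ^ d))"
    using k by (simp add: log_nat_power)
  also have "\<dots> \<le> L"
    using k kd \<open>0 < k ^ d\<close> n unfolding L_def by (intro log_mono) (auto simp del: of_nat_power)
  finally have dL: "real d \<le> L" .
  have "ln (real n) = ln (real k) * L"
    using k n by (simp add: L_def log_def)
  also have "\<dots> \<le> real k * L"
    using k dL ln_le_minus_one[of "real k"] by (intro mult_right_mono) auto
  finally have "real n \<le> exp (real k * L)"
    using n by (metis exp_le_cancel_iff exp_ln of_nat_0_less_iff)
  also have "\<dots> \<le> exp (ln \<alpha> * real (k * d) + (1 - ln \<alpha>) * real k * L)"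
  proof -
    have "ln \<alpha> * (real k * L) \<le> ln \<alpha> * real (k * d)"
      using \<alpha> dL by (intro mult_left_mono_neg) (auto intro: mult_left_mono)
    then show ?thesis
      by (simp add: algebra_simps)
  qed
  also have "\<dots> = \<alpha> ^ (k * d) * exp ((1 - ln \<alpha>) * real k * L)"
    using \<alpha> by (simp add: exp_add mult.commute[of "ln \<alpha>"] exp_of_nat_mult del: of_nat_mult)
  also have "\<dots> \<le> \<alpha> ^ (k * d) * real T"
    using \<alpha> T by (intro mult_left_mono) (auto simp: \<alpha>_def L_def)
  finally have "real (k ^ d) * exp (- (\<alpha> ^ (k * d) * real T)) \<le> real n * exp (- real n)"
    using kd by (intro mult_mono) (auto simp del: of_nat_power)
  then show ?thesis
    using prob_consistent_estimator[OF assms(1,3), of T] by (simp add: \<alpha>_def)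
qed

end

text \<open>The quadratic Taylor bound for \<open>exp\<close> gives an explicit rate, from which a
  threshold for \<open>n\<close> can be read off.\<close>

lemma mult_exp_minus_le:
  fixes x :: real
  assumes "0 < x"
  shows "x * exp (- x) \<le> 2 / x"
proof -
  have "x\<^sup>2 / 2 \<le> exp x"
    using exp_lower_Taylor_quadratic[of x] assms by simp
  then show ?thesis
    using assms by (simp add: exp_minus field_simps power2_eq_square)
qed

theorem theorem2:
  fixes c :: nat and q :: real
  assumes "0 < c" and "0 \<le> q" and "q < real c / (real c + 1)"
  shows "\<exists>C :: real. \<exists>est :: unit rtree \<Rightarrow> bool rtree list \<Rightarrow> bool rtree.
           \<forall>\<epsilon>::real. \<epsilon> > 0 \<longrightarrow> (\<exists>N::nat. \<forall>k::nat. k > c \<longrightarrow>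
             (\<forall>X :: bool rtree. complete_kary k X \<longrightarrow> num_nonroot X \<ge> N \<longrightarrow>
               (let T = nat \<lceil>exp (C * real k * log (real k) (real (num_nonroot X)))\<rceil>
                in measure_pmf.prob (replicate_pmf T (ted_trace q X))
                     {Ys. est (tree_topology X) Ys = X} \<ge> 1 - \<epsilon>)))"
proof -
  interpret supercritical_deletion c q
    using assms by unfold_locales
  define C where "C = 1 - ln ((1 - q) * \<theta>)"
  show ?thesis
  proof (intro exI[of _ C] exI[of _ consistent_estimator] allI impI)
    fix \<epsilon> :: real
    assume \<epsilon>: "0 < \<epsilon>"
    \<comment> \<open>Chosen so that \<open>2 / n \<le> \<epsilon>\<close> for
      \<open>n \<ge> N\<close>, independently of \<open>k\<close>; positivity of \<open>N\<close>
      excludes the tree consisting of the root alone.\<close>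
    define N where "N = Suc (nat \<lceil>2 / \<epsilon>\<rceil>)"
    have "1 - \<epsilon> \<le> measure_pmf.prob
        (replicate_pmf (nat \<lceil>exp (C * real k * log (real k) (real (num_nonroot X)))\<rceil>)
          (ted_trace q X)) {Ys. consistent_estimator (tree_topology X) Ys = X}"
      if "c < k" "complete_kary k X" and N: "N \<le> num_nonroot X" for k and X :: "bool rtree"
    proof -
      let ?n = "num_nonroot X"
      obtain d where d: "kary_forest k d (children X)"
        using \<open>complete_kary k X\<close> by (auto simp: complete_kary_def)
      have "0 < d"
        using d N by (cases d) (auto simp: N_def num_nonroot_def)
      have "2 / \<epsilon> \<le> real ?n" "0 < ?n"
        using N unfolding N_def by linarith+
      then have "2 / real ?n \<le> \<epsilon>"
        using \<epsilon> by (simp add: field_simps)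
      then have "real ?n * exp (- real ?n) \<le> \<epsilon>"
        using mult_exp_minus_le[of "real ?n"] \<open>0 < ?n\<close> by simp
      then show ?thesis
        using consistent_estimator_sample_complexity[OF \<open>c < k\<close> \<open>0 < c\<close> d \<open>0 < d\<close>,
            of "nat \<lceil>exp (C * real k * log (real k) (real ?n))\<rceil>"]
        unfolding C_def by (smt (verit) real_nat_ceiling_ge)
    qed
    then show "\<exists>N. \<forall>k>c. \<forall>X :: bool rtree. complete_kary k X \<longrightarrow> N \<le> num_nonroot X \<longrightarrow>
        (let T = nat \<lceil>exp (C * real k * log (real k) (real (num_nonroot X)))\<rceil>
         in 1 - \<epsilon> \<le> measure_pmf.prob (replicate_pmf T (ted_trace q X))
              {Ys. consistent_estimator (tree_topology X) Ys = X})"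
      unfolding Let_def by blast
  qed
qed

end
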